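(* Let $n\ge1$, $\mu>2$, and let $\delta>0$ be the unique positive number with $\mu\log(1+\delta)-2\delta=0$ (so that $\mu\log(1+r)-2r>0$ for $0<r<\delta$ and $\mu\log(1+r)-2r<0$ for $r>\delta$). There are a constant $C>0$ depending only on $n$ and $\mu$, and a constant $\alpha>0$, such that the following holds. Let $u_0\in H^1({\bf R}^n)\cap L^1({\bf R}^n)$ and $u_1\in L^2({\bf R}^n)\cap L^{1,1}({\bf R}^n)$, let $P_1:=\int_{{\bf R}^n}u_1(x)\,dx$, and let $u(t,x)$ be the solution of $$u_{tt}-\Delta u+\mu L u_t=0\ \text{ in }(0,\infty)\times{\bf R}^n,\qquad u(0,x)=u_0(x),\quad u_t(0,x)=u_1(x),\ x\in{\bf R}^n.$$ Then, for all sufficiently large $t$, $$\Vert{\cal F}_{x\to\xi}(u(t,\cdot))(\xi)-\nu(t,\cdot)\Vert_{L^2(|\xi|\le\delta)}\le C\big(\Vert u_0\Vert+\Vert u_0\Vert_1+\Vert u_1\Vert+\Vert u_1\Vert_{1,1}\big)t^{-\frac n2}$$ and $$\Vert{\cal F}_{x\to\xi}(u(t,\cdot))(\xi)\Vert_{L^2(|\xi|\ge\delta)}\le C\big(\Vert u_0\Vert_1+\Vert u_1\Vert_1\big)e^{-\alpha t},$$ where, with $r=|\xi|$, $$\nu(t,\xi):=P_1\,\frac{e^{\lambda_+t}-e^{\lambda_-t}}{\sqrt{\mu^2\log^2(1+r)-4r^2}}\quad(|\xi|<\delta),\qquad\lambda_\pm:=-\frac{\mu\log(1+r)}{2}\p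m\frac{\sqrt{\mu^2\log^2(1+r)-4r^2}}{2}\quad(|\xi|\le\delta).$$
   Context: Fourier transform: ${\cal F}_{x\to\xi}(f)(\xi)=\hat f(\xi)=\int_{{\bf R}^n}e^{-ix\cdot\xi}f(x)\,dx$, with inverse ${\cal F}^{-1}_{\xi\to x}$. The operator $L=\log(I+(-\Delta)^{1/2})$ on $L^2({\bf R}^n)$ is the Fourier multiplier $(Lf)(x)={\cal F}^{-1}_{\xi\to x}(\log(1+|\xi|)\hat f(\xi))(x)$ with domain $D(L)=\{f\in L^2:\int(1+\log^2(1+|\xi|))|\hat f(\xi)|^2d\xi<\infty\}$. For $(u_0,u_1)\in H^1({\bf R}^n)\times L^2({\bf R}^n)$ "the solution" is the unique mild solution $u\in C([0,\infty);H^1({\bf R}^n))\cap C^1([0,\infty);L^2({\bf R}^n))$; equivalently, $w(t,\xi)=\hat u(t,\xi)$ (Fourier transform in $x$) solves $w_{tt}+\mu\log(1+|\xi|)w_t+|\xi|^2w=0$, $w(0,\xi)=\hat u_0(\xi)$, $w_t(0,\xi)=\hat u_1(\xi)$. Norms: $\Vert\cdot\Vert_q$ is the $L^q({\bf R}^n)$-norm, $\Vert\cdot\Vert=\Vert\cdot\Vert_2$, and $L^{1,1}({\bf R}^n)=\{f\in L^1:\Vert f\Vert_{1,1}:=\int_{{\bf R}^n}(1+|x|)|f(x)|dx<\infty\}$. The function $\nu(t,\cdot)$ is regarded as defined almost everywhere on $|\xi|\le\delta$ (i.e. for $0<|\xi|<\delta$). *)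

theory Defs
  imports "HOL-Analysis.Analysis"
begin

text \<open>
  All function spaces consist of complex-valued functions, with respect to Lebesgue measure.
  Membership in a space is stated by a separate predicate, since the Bochner integral of a
  non-integrable function is 0 and a bare bound on a norm would not imply it.
\<close>

definition in_L1 :: "('a::euclidean_space \<Rightarrow> complex) \<Rightarrow> bool" where
  "in_L1 f \<longleftrightarrow> integrable lebesgue f"

definition L1_norm :: "('a::euclidean_space \<Rightarrow> complex) \<Rightarrow> real" where
  "L1_norm f = (\<integral>x. norm (f x) \<partial>lebesgue)"

definition in_L11 :: "('a::euclidean_space \<Rightarrow> complex) \<Rightarrow> bool" where
  "in_L11 f \<longleftrightarrow> in_L1 f \<and> integrable lebesgue (\<lambda>x. (1 + norm x) * norm (f x))"

definition L11_norm :: "('a::euclidean_space \<Rightarrow> complex) \<Rightarrow> real" where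
  "L11_norm f = (\<integral>x. (1 + norm x) * norm (f x) \<partial>lebesgue)"

definition in_L2_on :: "'a::euclidean_space set \<Rightarrow> ('a \<Rightarrow> complex) \<Rightarrow> bool" where
  "in_L2_on S f \<longleftrightarrow>
     f \<in> borel_measurable (lebesgue_on S) \<and> integrable (lebesgue_on S) (\<lambda>x. (norm (f x))\<^sup>2)"

definition L2_norm_on :: "'a::euclidean_space set \<Rightarrow> ('a \<Rightarrow> complex) \<Rightarrow> real" where
  "L2_norm_on S f = sqrt (\<integral>x. (norm (f x))\<^sup>2 \<partial>(lebesgue_on S))"

abbreviation in_L2 :: "('a::euclidean_space \<Rightarrow> complex) \<Rightarrow> bool" where
  "in_L2 \<equiv> in_L2_on UNIV"

abbreviation L2_norm :: "('a::euclidean_space \<Rightarrow> complex) \<Rightarrow> real" where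
  "L2_norm \<equiv> L2_norm_on UNIV"

text \<open>
  Convergence in $L^2$.  The integral is the extended nonnegative one, so that a difference
  outside $L^2$ counts as infinitely far away.
\<close>

definition L2_tendsto ::
    "('b \<Rightarrow> 'a::euclidean_space \<Rightarrow> complex) \<Rightarrow> ('a \<Rightarrow> complex) \<Rightarrow> 'b filter \<Rightarrow> bool" where
  "L2_tendsto f g F \<longleftrightarrow>
     ((\<lambda>s. \<integral>\<^sup>+x. ennreal ((norm (f s x - g x))\<^sup>2) \<partial>lebesgue) \<longlongrightarrow> 0) F"

definition fourier_integral ::
    "('a::euclidean_space \<Rightarrow> complex) \<Rightarrow> 'a \<Rightarrow> complex" where
  "fourier_integral f \<xi> = (\<integral>x. exp (- \<i> * of_real (x \<bullet> \<xi>)) * f x \<partial>lebesgue)"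

text \<open>
  The Fourier(-Plancherel) transform on $L^2$, defined up to null sets as the $L^2$-limit of the
  Fourier integrals over the balls of radius $R$ as $R \to \infty$.
\<close>

definition has_fourier ::
    "('a::euclidean_space \<Rightarrow> complex) \<Rightarrow> ('a \<Rightarrow> complex) \<Rightarrow> bool" where
  "has_fourier f g \<longleftrightarrow> in_L2 f \<and> in_L2 g \<and>
     L2_tendsto (\<lambda>R. fourier_integral (\<lambda>x. indicator (cball 0 R) x *\<^sub>R f x)) g at_top"

definition fourier :: "('a::euclidean_space \<Rightarrow> complex) \<Rightarrow> 'a \<Rightarrow> complex" where
  "fourier f = (SOME g. has_fourier f g)"

definition in_H1 :: "('a::euclidean_space \<Rightarrow> complex) \<Rightarrow> bool" where
  "in_H1 f \<longleftrightarrow> in_L2 f \<and> integrable lebesgue (\<lambda>\<xi>. (1 + (norm \<xi>)\<^sup>2) * (norm (fourier f \<xi>))\<^sup>2)"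

definition H1_tendsto ::
    "('b \<Rightarrow> 'a::euclidean_space \<Rightarrow> complex) \<Rightarrow> ('a \<Rightarrow> complex) \<Rightarrow> 'b filter \<Rightarrow> bool" where
  "H1_tendsto f g F \<longleftrightarrow>
     ((\<lambda>s. \<integral>\<^sup>+\<xi>. ennreal ((1 + (norm \<xi>)\<^sup>2) * (norm (fourier (\<lambda>x. f s x - g x) \<xi>))\<^sup>2) \<partial>lebesgue)
        \<longlongrightarrow> 0) F"

text \<open>The symbol of the Fourier multiplier $L = \log(I + (-\Delta)^{1/2})$.\<close>

definition L_symbol :: "'a::euclidean_space \<Rightarrow> real" where
  "L_symbol \<xi> = ln (1 + norm \<xi>)"

text \<open>
  \<open>mild_solution \<mu> u0 u1 u\<close>: the function \<open>u\<close> (only its values at times \<open>t \<ge> 0\<close> matter) is in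
  $C([0,\infty); H^1) \cap C^1([0,\infty); L^2)$, with time derivative \<open>v\<close>, and solves
  $u_{tt} - \Delta u + \mu L u_t = 0$, $u(0) = u_0$, $u_t(0) = u_1$.  As \<open>v t\<close> need not belong to
  the domain of $L$, nor \<open>u t\<close> to that of $\Delta$, the equation is imposed on the Fourier side:
  suitable representatives \<open>w t\<close>, \<open>w' t\<close> of the Fourier transforms of \<open>u t\<close>, \<open>v t\<close> satisfy, for
  almost every \<open>\<xi>\<close>, the ordinary differential equation
  $w_{tt} + \mu \log(1+|\xi|) w_t + |\xi|^2 w = 0$ on $[0,\infty)$.
\<close>

definition mild_solution ::
    "real \<Rightarrow> ('a::euclidean_space \<Rightarrow> complex) \<Rightarrow> ('a \<Rightarrow> complex) \<Rightarrow> (real \<Rightarrow> 'a \<Rightarrow> complex) \<Rightarrow> bool"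
  where
  "mild_solution \<mu> u0 u1 u \<longleftrightarrow> (\<exists>v w w'.
     (\<forall>t\<ge>0. in_H1 (u t) \<and> H1_tendsto u (u t) (at t within {0..})) \<and>
     (\<forall>t\<ge>0. in_L2 (v t) \<and> L2_tendsto v (v t) (at t within {0..})) \<and>
     (\<forall>t\<ge>0. L2_tendsto (\<lambda>s x. (u s x - u t x) / of_real (s - t)) (v t) (at t within {0..})) \<and>
     (AE x in lebesgue. u 0 x = u0 x) \<and>
     (AE x in lebesgue. v 0 x = u1 x) \<and>
     (\<forall>t\<ge>0. has_fourier (u t) (w t) \<and> has_fourier (v t) (w' t)) \<and>
     (AE \<xi> in lebesgue. \<forall>t\<ge>0.
        ((\<lambda>s. w s \<xi>) has_vector_derivative w' t \<xi>) (at t within {0..}) \<and>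
        ((\<lambda>s. w' s \<xi>) has_vector_derivative
           - (of_real (\<mu> * L_symbol \<xi>) * w' t \<xi> + of_real ((norm \<xi>)\<^sup>2) * w t \<xi>))
          (at t within {0..})))"

definition lambda_plus :: "real \<Rightarrow> real \<Rightarrow> real" where
  "lambda_plus \<mu> r = - (\<mu> * ln (1 + r)) / 2 + sqrt (\<mu>\<^sup>2 * (ln (1 + r))\<^sup>2 - 4 * r\<^sup>2) / 2"

definition lambda_minus :: "real \<Rightarrow> real \<Rightarrow> real" where
  "lambda_minus \<mu> r = - (\<mu> * ln (1 + r)) / 2 - sqrt (\<mu>\<^sup>2 * (ln (1 + r))\<^sup>2 - 4 * r\<^sup>2) / 2"

text \<open>
  The profile.  Only the values for $0 < |\xi| < \delta$ are meaningful; the denominator vanishes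
  on the null set where $|\xi| \in \{0, \delta\}$.
\<close>

definition nu :: "real \<Rightarrow> complex \<Rightarrow> real \<Rightarrow> 'a::euclidean_space \<Rightarrow> complex" where
  "nu \<mu> P1 t \<xi> = (let r = norm \<xi> in
     P1 * of_real ((exp (lambda_plus \<mu> r * t) - exp (lambda_minus \<mu> r * t)) /
                   sqrt (\<mu>\<^sup>2 * (ln (1 + r))\<^sup>2 - 4 * r\<^sup>2)))"

text \<open>Existence and uniqueness of the threshold frequency $\delta$.\<close>

lemma threshold_exists:
  fixes \<mu> :: real
  assumes "\<mu> > 2"
  obtains \<delta> where "\<delta> > 0" "\<mu> * ln (1 + \<delta>) - 2 * \<delta> = 0"
    "\<And>r. 0 < r \<Longrightarrow> r < \<delta> \<Longrightarrow> \<mu> * ln (1 + r) - 2 * r > 0"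
    "\<And>r. \<delta> < r \<Longrightarrow> \<mu> * ln (1 + r) - 2 * r < 0"
proof -
  define f where "f r = \<mu> * ln (1 + r) - 2 * r" for r :: real
  define m where "m = \<mu> / 2 - 1"
  have m: "m > 0" using assms by (simp add: m_def)
  have der: "(f has_real_derivative (\<mu> / (1 + r) - 2)) (at r)" if "r \<ge> 0" for r
    unfolding f_def using that by (auto intro!: derivative_eq_intros)
  have cont: "isCont f r" if "r \<ge> 0" for r
    using der[OF that] by (rule DERIV_isCont)
  have inc: "f a < f b" if "0 \<le> a" "a < b" "b \<le> m" for a b
  proof (rule DERIV_pos_imp_increasing_open[OF \<open>a < b\<close>])
    fix x assume x: "a < x" "x < b"
    have "\<mu> / (1 + x) - 2 > 0" using x that by (simp add: m_def field_simps)
    then show "\<exists>y. (f has_real_derivative y) (at x) \<and> y > 0" using der[of x] x that by auto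
  next
    show "continuous_on {a..b} f"
      by (rule continuous_at_imp_continuous_on) (use that cont in auto)
  qed
  have dec: "f b < f a" if "m \<le> a" "a < b" for a b
  proof (rule DERIV_neg_imp_decreasing_open[OF \<open>a < b\<close>])
    fix x assume x: "a < x" "x < b"
    have "\<mu> / (1 + x) - 2 < 0" using x that m by (simp add: m_def field_simps)
    then show "\<exists>y. (f has_real_derivative y) (at x) \<and> y < 0" using der[of x] x that m by auto
  next
    show "continuous_on {a..b} f"
      by (rule continuous_at_imp_continuous_on) (use that m cont in auto)
  qed
  have f0: "f 0 = 0" by (simp add: f_def)
  have fm: "f m > 0" using inc[of 0 m] m f0 by simp
  define M where "M = \<mu>\<^sup>2 - 1"
  have "\<mu> * 2 \<le> \<mu> * \<mu>" using assms by (intro mult_left_mono) auto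
  then have M: "m < M" using assms by (simp add: m_def M_def power2_eq_square)
  have "ln (1 + M) = 2 * ln \<mu>" using assms by (simp add: M_def ln_realpow)
  also have "\<dots> \<le> 2 * (\<mu> - 1)" using ln_le_minus_one[of \<mu>] assms by simp
  finally have "\<mu> * ln (1 + M) \<le> \<mu> * (2 * (\<mu> - 1))" using assms by (intro mult_left_mono) auto
  then have fM: "f M < 0" using assms by (simp add: f_def M_def power2_eq_square algebra_simps)
  have "\<exists>\<delta>\<ge>m. \<delta> \<le> M \<and> f \<delta> = 0"
    by (rule IVT2) (use fm fM M m cont in auto)
  then obtain \<delta> where \<delta>: "m \<le> \<delta>" "f \<delta> = 0" by blast
  show ?thesis
  proof
    show "\<delta> > 0" using m \<delta> by simp
    show "\<mu> * ln (1 + \<delta>) - 2 * \<delta> = 0" using \<delta> by (simp add: f_def)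
    show "\<mu> * ln (1 + r) - 2 * r > 0" if "0 < r" "r < \<delta>" for r
      using inc[of 0 r] dec[of r \<delta>] that \<delta> f0 by (cases "r \<le> m") (auto simp: f_def)
    show "\<mu> * ln (1 + r) - 2 * r < 0" if "\<delta> < r" for r
      using dec[of \<delta> r] that \<delta> by (simp add: f_def)
  qed
qed

lemma threshold_ex1:
  fixes \<mu> :: real
  assumes "\<mu> > 2"
  shows "\<exists>!\<delta>. \<delta> > 0 \<and> \<mu> * ln (1 + \<delta>) - 2 * \<delta> = 0"
  by (rule threshold_exists[OF assms]) (metis less_irrefl linorder_neqE)

end

theory Submission
  imports Defs
begin

text \<open>
  On the Fourier side the equation is, for almost every \<open>\<xi>\<close>, the damped oscillator
  \<open>w'' + \<mu> ln (1 + r) w' + r\<^sup>2 w = 0\<close> with \<open>r = |\<xi>|\<close>.  If \<open>l\<close>, \<open>m\<close> are its distinct characteristic roots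
  and \<open>D\<close> is the divided difference of \<open>\<lambda> \<mapsto> exp (\<lambda> t)\<close> at them, the solution is
  \<open>w t = w 0 (exp (l t) - l D) + w' 0 D\<close> (\<open>second_order_ode_solution\<close>), and the mean value
  inequality gives \<open>|D| \<le> t exp (c t)\<close> where \<open>c\<close> is the larger real part
  (\<open>norm_exp_divided_difference_le\<close>).

  For \<open>r < \<delta>\<close> the roots are real, with \<open>lambda_plus \<mu> r \<le> - r / \<mu>\<close> and
  \<open>|lambda_plus \<mu> r| \<le> r\<close> (\<open>lambda_low_frequency\<close>).
  The profile is \<open>P D\<close>, with \<open>P\<close> the integral of \<open>u1\<close>, and the transform of \<open>u1\<close> differs from \<open>P\<close> by
  at most \<open>r\<close> times the weighted norm of \<open>u1\<close>.  So each occurrence of \<open>D\<close> in the remainder comes with a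
  factor \<open>r\<close>, and the remainder is bounded by a multiple of \<open>(1 + r t) exp (- r t / \<mu>)\<close>
  (\<open>low_frequency_remainder_bound\<close>).  The square of a rapidly decreasing function of \<open>t |\<xi>|\<close> has
  integral of order \<open>t ^ - n\<close> (\<open>nn_integral_radial_power_bound\<close>), and the square root is the claimed
  rate.

  For \<open>r > \<delta>\<close> the roots are complex conjugates of real part \<open>- \<mu> ln (1 + r) / 2\<close>
  (\<open>lambda_high_frequency\<close>), so \<open>w\<close> decays like a power of \<open>1 + r\<close> whose exponent grows
  linearly in \<open>t\<close> (\<open>high_frequency_bound\<close>).  For large \<open>t\<close> a fixed part of the exponent makes the bound
  square integrable, and on the rest \<open>1 + r \<ge> 1 + \<delta>\<close> gives exponential decay in \<open>t\<close>.

  It remains to connect the transform, an \<open>L\<^sup>2\<close> limit determined up to null sets, with the Fourier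
  integrals of the integrable data: \<open>has_fourier_unique\<close> and \<open>has_fourier_fourier_integral\<close>
  do this, and \<open>mild_solution_fourier\<close> combines them with the formula for \<open>w\<close>.
\<close>

section \<open>Linear second-order equations with constant coefficients\<close>

text \<open>
  The divided difference of \<open>\<lambda> \<mapsto> exp (\<lambda> t)\<close> at the two characteristic roots: the solution of the
  second-order equation with data \<open>w 0 = 0\<close>, \<open>w' 0 = 1\<close>.  In this form it covers real roots and
  complex conjugate roots at once.
\<close>
definition exp_divided_difference :: "complex \<Rightarrow> complex \<Rightarrow> real \<Rightarrow> complex" where
  "exp_divided_difference l m t = (exp (l * of_real t) - exp (m * of_real t)) / (l - m)"

text \<open>
  The mean value inequality on the half-plane of real part at most \<open>c\<close>, which is convex and
  on which the derivative of the exponential is bounded by \<open>exp c\<close>.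
\<close>
lemma norm_exp_diff_le:
  fixes z w :: complex
  assumes "Re z \<le> c" "Re w \<le> c"
  shows "norm (exp z - exp w) \<le> exp c * norm (z - w)"
  by (rule field_differentiable_bound[where S = "{z. Re z \<le> c}" and f' = exp])
     (use assms in \<open>auto intro!: convex_halfspace_Re_le derivative_eq_intros simp: norm_exp_eq_Re\<close>)

text \<open>
  The bound does not see the distance of the roots, so it stays uniform up to the frequencies
  where they merge.
\<close>
lemma norm_exp_divided_difference_le:
  assumes "Re l \<le> c" "Re m \<le> c" "t \<ge> 0"
  shows "norm (exp_divided_difference l m t) \<le> t * exp (c * t)"
proof (cases "l = m")
  case False
  have "norm (exp (l * of_real t) - exp (m * of_real t)) \<le> exp (c * t) * norm (l * of_real t - m * of_real t)"
    by (rule norm_exp_diff_le) (use assms in \<open>auto intro!: mult_right_mono\<close>)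
  also have "norm (l * of_real t - m * of_real t) = t * norm (l - m)"
    using assms by (simp flip: left_diff_distrib add: norm_mult)
  finally show ?thesis
    using False by (simp add: exp_divided_difference_def norm_divide divide_simps mult_ac)
qed (use assms in \<open>simp add: exp_divided_difference_def\<close>)

text \<open>
  The product \<open>p s * exp (- c s)\<close> has derivative zero, hence is constant.
\<close>
lemma linear_ode_solution:
  fixes p :: "real \<Rightarrow> complex"
  assumes p: "\<And>s. s \<ge> 0 \<Longrightarrow> (p has_vector_derivative c * p s) (at s within {0..})"
    and "t \<ge> 0"
  shows "p t = p 0 * exp (c * of_real t)"
proof -
  define q where "q s = p s * exp (- c * of_real s)" for s
  have "(q has_derivative (\<lambda>h. 0)) (at s within {0..})" if "s \<in> {0..}" for s
  proof -
    have "((\<lambda>s. exp (- c * of_real s)) has_vector_derivative (- c * exp (- c * of_real s))) (at s within {0..})"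
      by (rule has_vector_derivative_real_field) (auto intro!: derivative_eq_intros)
    from has_vector_derivative_mult[OF p this] that
    have "(q has_vector_derivative 0) (at s within {0..})"
      by (simp add: q_def[abs_def] mult_ac)
    then show ?thesis by (simp add: has_vector_derivative_def)
  qed
  then have "q t = q 0"
    by (metis has_derivative_zero_unique atLeast_iff convex_real_interval(1) assms(2) order_refl)
  then have "p t * exp (- c * of_real t) * exp (c * of_real t) = p 0 * exp (c * of_real t)"
    by (simp add: q_def)
  then show ?thesis by (simp add: mult.assoc flip: exp_add)
qed

text \<open>
  Factor the operator as \<open>(d/dt - l) (d/dt - m)\<close>.  Then \<open>w' - m w\<close> and \<open>w' - l w\<close> solve first-order
  equations with rates \<open>l\<close> and \<open>m\<close>, and since \<open>l\<close> differs from \<open>m\<close>, both together determine \<open>w\<close>.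
\<close>
lemma second_order_ode_solution:
  fixes w w' :: "real \<Rightarrow> complex"
  assumes w: "\<And>s. s \<ge> 0 \<Longrightarrow> (w has_vector_derivative w' s) (at s within {0..})"
    and w': "\<And>s. s \<ge> 0 \<Longrightarrow> (w' has_vector_derivative - (b * w' s + k * w s)) (at s within {0..})"
    and roots: "l + m = - b" "l * m = k" "l \<noteq> m"
    and t: "t \<ge> 0"
  shows "w t = w 0 * (exp (l * of_real t) - l * exp_divided_difference l m t)
               + w' 0 * exp_divided_difference l m t"
proof -
  \<comment> \<open>Stated for both orders of the two roots at once.\<close>
  have *: "w' t - y * w t = (w' 0 - y * w 0) * exp (x * of_real t)" if "x + y = - b" "x * y = k" for x y
  proof (rule linear_ode_solution[where p = "\<lambda>s. w' s - y * w s", OF _ t])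
    fix s :: real assume s: "s \<ge> 0"
    have b: "b = - x - y" using that(1) by algebra
    have "((\<lambda>s. w' s - y * w s) has_vector_derivative - (b * w' s + k * w s) - y * w' s) (at s within {0..})"
      by (intro derivative_intros has_vector_derivative_mult_right w w' s)
    also have "- (b * w' s + k * w s) - y * w' s = x * (w' s - y * w s)"
      unfolding b that(2)[symmetric] by (simp add: algebra_simps)
    finally show "((\<lambda>s. w' s - y * w s) has_vector_derivative x * (w' s - y * w s)) (at s within {0..})" .
  qed
  have "w' t - m * w t = (w' 0 - m * w 0) * exp (l * of_real t)"
    by (rule *) (use roots in auto)
  moreover have "w' t - l * w t = (w' 0 - l * w 0) * exp (m * of_real t)"
    by (rule *) (use roots in \<open>auto simp: add.commute mult.commute\<close>)
  ultimately have "(l - m) * w t = (w' 0 - m * w 0) * exp (l * of_real t) - (w' 0 - l * w 0) * exp (m * of_real t)"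
    by algebra
  then have "w t = ((w' 0 - m * w 0) * exp (l * of_real t) - (w' 0 - l * w 0) * exp (m * of_real t)) / (l - m)"
    using roots(3) by (simp add: field_simps)
  then show ?thesis
    using roots(3) by (simp add: exp_divided_difference_def divide_simps) (simp add: algebra_simps)
qed

section \<open>Characteristic roots below and above the threshold\<close>

text \<open>
  The roots are negative with product \<open>r\<^sup>2\<close>.  As \<open>- lambda_minus \<mu> r \<le> \<mu> ln (1 + r) \<le> \<mu> r\<close>, the
  other root satisfies \<open>- lambda_plus \<mu> r \<ge> r / \<mu>\<close>: the slow mode decays at a rate proportional to
  \<open>r\<close>.  Being the smaller one in modulus, it is also at most the geometric mean \<open>r\<close>.
\<close>
lemma lambda_low_frequency:
  assumes \<mu>: "\<mu> > 2" and r: "r > 0" "2 * r < \<mu> * ln (1 + r)"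
  shows "lambda_plus \<mu> r + lambda_minus \<mu> r = - (\<mu> * ln (1 + r))"
    and "lambda_plus \<mu> r * lambda_minus \<mu> r = r\<^sup>2"
    and "lambda_plus \<mu> r - lambda_minus \<mu> r = sqrt (\<mu>\<^sup>2 * (ln (1 + r))\<^sup>2 - 4 * r\<^sup>2)"
    and "lambda_minus \<mu> r < lambda_plus \<mu> r"
    and "lambda_plus \<mu> r \<le> - r / \<mu>"
    and "\<bar>lambda_plus \<mu> r\<bar> \<le> r"
proof -
  define b where "b = \<mu> * ln (1 + r)"
  define d where "d = sqrt (b\<^sup>2 - 4 * r\<^sup>2)"
  have "(2 * r)\<^sup>2 < b\<^sup>2"
    using r by (intro power_strict_mono) (auto simp: b_def)
  then have b2: "b\<^sup>2 - 4 * r\<^sup>2 > 0" by simp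
  then have d: "d > 0" "d\<^sup>2 = b\<^sup>2 - 4 * r\<^sup>2" by (auto simp: d_def)
  have lam: "lambda_plus \<mu> r = (d - b) / 2" "lambda_minus \<mu> r = - (d + b) / 2"
    by (auto simp: lambda_plus_def lambda_minus_def d_def b_def power_mult_distrib field_simps)
  have b: "b > 0" using r by (simp add: b_def)
  show sum: "lambda_plus \<mu> r + lambda_minus \<mu> r = - (\<mu> * ln (1 + r))"
    by (simp add: lambda_plus_def lambda_minus_def)
  show prod: "lambda_plus \<mu> r * lambda_minus \<mu> r = r\<^sup>2"
    unfolding lam using d(2) by (simp add: power2_eq_square algebra_simps)
  show diff: "lambda_plus \<mu> r - lambda_minus \<mu> r = sqrt (\<mu>\<^sup>2 * (ln (1 + r))\<^sup>2 - 4 * r\<^sup>2)"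
    unfolding lam by (simp add: d_def b_def power_mult_distrib field_simps)
  show less: "lambda_minus \<mu> r < lambda_plus \<mu> r" unfolding lam using d by (simp add: field_simps)
  have neg: "lambda_minus \<mu> r < 0" unfolding lam using d b by simp
  have pos: "lambda_plus \<mu> r < 0" 
  proof -
    have "lambda_plus \<mu> r * lambda_minus \<mu> r > 0" using prod r(1) by simp
    then show ?thesis using neg by (simp add: zero_less_mult_iff)
  qed
  have "b \<le> \<mu> * r" using ln_add_one_self_le_self[of r] r \<mu> by (simp add: b_def)
  then have "- lambda_minus \<mu> r \<le> \<mu> * r" using sum pos by (simp add: b_def)
  then have "(- lambda_plus \<mu> r) * (- lambda_minus \<mu> r) \<le> (- lambda_plus \<mu> r) * (\<mu> * r)"
    using pos by (intro mult_left_mono) auto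
  then have "r * r \<le> (- lambda_plus \<mu> r * \<mu>) * r"
    using prod by (simp add: power2_eq_square mult_ac)
  then have "r \<le> - lambda_plus \<mu> r * \<mu>"
    using r(1) by (rule mult_right_le_imp_le)
  then show "lambda_plus \<mu> r \<le> - r / \<mu>"
    using \<mu> by (simp add: field_simps)
  have "(- lambda_plus \<mu> r) * (- lambda_plus \<mu> r) \<le> (- lambda_plus \<mu> r) * (- lambda_minus \<mu> r)"
    using pos less by (intro mult_left_mono) auto
  then have "(lambda_plus \<mu> r)\<^sup>2 \<le> r\<^sup>2"
    using prod by (simp add: power2_eq_square)
  then show "\<bar>lambda_plus \<mu> r\<bar> \<le> r"
    using r(1) by (simp add: abs_le_square_iff[symmetric])
qed

text \<open>
  Above the threshold the discriminant is negative: the roots are complex conjugates, their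
  common modulus is the square root \<open>r\<close> of their product, and their real part gives the decay rate.
\<close>
lemma lambda_high_frequency:
  fixes \<mu> r :: real
  assumes r: "r > 0" "\<mu> * ln (1 + r) < 2 * r" and \<mu>: "\<mu> > 0"
  obtains l m :: complex where "l + m = - of_real (\<mu> * ln (1 + r))" "l * m = of_real (r\<^sup>2)" "l \<noteq> m"
    "Re l = - (\<mu> * ln (1 + r) / 2)" "Re m = - (\<mu> * ln (1 + r) / 2)" "norm l = r"
proof
  define b where "b = \<mu> * ln (1 + r)"
  define d where "d = sqrt (4 * r\<^sup>2 - b\<^sup>2)"
  have "b\<^sup>2 < (2 * r)\<^sup>2"
    using r \<mu> by (intro power_strict_mono) (auto simp: b_def)
  then have "4 * r\<^sup>2 - b\<^sup>2 > 0" by simp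
  then have d: "d > 0" "d\<^sup>2 = 4 * r\<^sup>2 - b\<^sup>2" by (auto simp: d_def)
  let ?l = "Complex (- (b / 2)) (d / 2)" and ?m = "Complex (- (b / 2)) (- (d / 2))"
  show "?l + ?m = - of_real (\<mu> * ln (1 + r))" "Re ?l = - (\<mu> * ln (1 + r) / 2)" "Re ?m = - (\<mu> * ln (1 + r) / 2)"
    by (auto simp: complex_eq_iff b_def)
  show "?l * ?m = of_real (r\<^sup>2)"
    using d(2) by (simp add: complex_eq_iff power2_eq_square field_simps)
  show "?l \<noteq> ?m" using d by simp
  show "norm ?l = r" using d(2) r by (simp add: complex_norm power_divide flip: add_divide_distrib)
qed

section \<open>Radial integrals\<close>

lemma power_quotient:
  fixes a :: real
  assumes "a \<noteq> 0"
  shows "a ^ (k + 4) / a ^ (k + 2) = a\<^sup>2"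
  using power_diff[of a "k + 2" "k + 4"] assms by simp

lemma sqrt_power_eq_powr:
  fixes t :: real
  assumes "t > 0"
  shows "sqrt (t ^ n) = t powr (n / 2)"
proof -
  have "sqrt (t ^ n) = (t powr n) powr (1 / 2)"
    unfolding powr_realpow[OF assms] by (rule powr_half_sqrt[symmetric]) (use assms in simp)
  also have "\<dots> = t powr (n / 2)" by (simp only: powr_powr) simp
  finally show ?thesis .
qed

text \<open>
  A single term of the series of \<open>exp (c (1 + y))\<close> already dominates \<open>(1 + y) ^ m\<close>, up to a
  constant factor.
\<close>
lemma power_times_exp_bounded:
  fixes c :: real
  assumes "c > 0"
  obtains K where "K > 0" "\<And>y. y \<ge> 0 \<Longrightarrow> (1 + y) ^ m * exp (- c * y) \<le> K"
proof
  show "exp c * fact m / c ^ m > 0" using assms by simp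
  fix y :: real assume y: "y \<ge> 0"
  have "(c * (1 + y)) ^ m / fact m \<le> exp (c * (1 + y))"
  proof -
    have "(\<lambda>n. (c * (1 + y)) ^ n /\<^sub>R fact n) sums exp (c * (1 + y))" by (rule exp_converges)
    from sum_le_suminf[OF sums_summable[OF this], of "{m}"] sums_unique[OF this] y assms
    show ?thesis by (simp add: divide_inverse mult.commute)
  qed
  then show "(1 + y) ^ m * exp (- c * y) \<le> exp c * fact m / c ^ m"
    using assms unfolding power_mult_distrib by (simp add: distrib_left exp_add exp_minus field_simps)
qed

text \<open>
  Split space into the shells \<open>k \<le> s |x| < k + 1\<close>.  On the \<open>k\<close>-th shell the integrand is at most
  \<open>1 / (1 + k) ^ (n + 2)\<close>, and the shell lies in a ball of volume proportional to
  \<open>((1 + k) / s) ^ n\<close>; the sum over \<open>k\<close> of \<open>1 / (1 + k)\<^sup>2\<close> is left.  The volume of the balls carries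
  the scaling \<open>s ^ - n\<close>, from which the rate of the low-frequency estimate comes.
\<close>
lemma nn_integral_radial_power_bound:
  obtains W where "W > 0"
    "\<And>s. s > 0 \<Longrightarrow> (\<integral>\<^sup>+x. ennreal (1 / (1 + s * norm x) ^ (DIM('a) + 2)) \<partial>(lebesgue :: 'a::euclidean_space measure))
        \<le> ennreal (W / s ^ DIM('a))"
proof
  let ?n = "DIM('a)"
  define V where "V = unit_ball_vol (real ?n)"
  have V: "V > 0" by (simp add: V_def)
  have sums: "(\<lambda>k. 1 / (1 + real k)\<^sup>2) sums (pi\<^sup>2 / 6)"
    using inverse_squares_sums by (simp add: add.commute)
  show "V * (pi\<^sup>2 / 6) > 0" using V by simp
  fix s :: real assume s: "s > 0"
  define g where "g k x = ennreal (1 / (1 + real k) ^ (?n + 2)) * indicator (ball (0::'a) ((1 + real k) / s)) x" for k x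
  have pt: "ennreal (1 / (1 + s * norm x) ^ (?n + 2)) \<le> (\<Sum>k. g k x)" for x :: 'a
  proof -
    define k where "k = nat \<lfloor>s * norm x\<rfloor>"
    have "real k = of_int \<lfloor>s * norm x\<rfloor>"
      using s by (simp add: k_def)
    then have k: "real k \<le> s * norm x" "s * norm x < 1 + real k"
      by linarith+
    have "ennreal (1 / (1 + s * norm x) ^ (?n + 2)) \<le> ennreal (1 / (1 + real k) ^ (?n + 2))"
      by (intro ennreal_leI divide_left_mono power_mono mult_pos_pos zero_less_power) (use k s in auto)
    also have "\<dots> = g k x" using k s by (simp add: g_def field_simps)
    also have "\<dots> \<le> (\<Sum>k. g k x)" using sum_le_suminf[of "\<lambda>k. g k x" "{k}"] by simp
    finally show ?thesis .
  qed
  have int_g: "(\<integral>\<^sup>+x. g k x \<partial>lebesgue) = ennreal (V / s ^ ?n * (1 / (1 + real k)\<^sup>2))" for k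
  proof -
    have "(\<integral>\<^sup>+x. g k x \<partial>lebesgue) = ennreal (1 / (1 + real k) ^ (?n + 2)) * ennreal (V * ((1 + real k) / s) ^ ?n)"
      unfolding g_def using s
      by (subst nn_integral_cmult_indicator) (auto simp: emeasure_ball V_def)
    also have "\<dots> = ennreal (V / s ^ ?n * (1 / (1 + real k)\<^sup>2))"
      using V s by (simp flip: ennreal_mult add: power_divide power_add power2_eq_square)
    finally show ?thesis .
  qed
  have "(\<integral>\<^sup>+x. ennreal (1 / (1 + s * norm x) ^ (?n + 2)) \<partial>(lebesgue :: 'a measure)) \<le> (\<integral>\<^sup>+x. (\<Sum>k. g k x) \<partial>lebesgue)"
    by (intro nn_integral_mono pt)
  also have "\<dots> = (\<Sum>k. \<integral>\<^sup>+x. g k x \<partial>lebesgue)"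
    unfolding g_def by (intro nn_integral_suminf borel_measurable_times_ennreal borel_measurable_indicator) auto
  also have "\<dots> = ennreal (V / s ^ ?n * (pi\<^sup>2 / 6))"
    unfolding int_g using V s sums_mult[OF sums, of "V / s ^ ?n"]
    by (intro suminf_ennreal_eq) auto
  finally show "(\<integral>\<^sup>+x. ennreal (1 / (1 + s * norm x) ^ (?n + 2)) \<partial>(lebesgue :: 'a measure)) \<le> ennreal (V * (pi\<^sup>2 / 6) / s ^ ?n)"
    by (simp add: mult.commute)
qed

section \<open>The Fourier transform on $L^1$ and $L^2$\<close>

lemma integrable_fourier_integrand:
  fixes f :: "'a::euclidean_space \<Rightarrow> complex"
  assumes "integrable lebesgue f"
  shows "integrable lebesgue (\<lambda>x. exp (- \<i> * of_real (x \<bullet> \<xi>)) * f x)"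
proof (rule Bochner_Integration.integrable_bound[OF assms])
  have "(\<lambda>x. exp (- \<i> * of_real (x \<bullet> \<xi>))) \<in> borel_measurable borel"
    by (intro borel_measurable_continuous_onI continuous_intros)
  then have "(\<lambda>x. exp (- \<i> * of_real (x \<bullet> \<xi>))) \<in> borel_measurable lebesgue"
    by (intro measurable_completion) simp
  then show "(\<lambda>x. exp (- \<i> * of_real (x \<bullet> \<xi>)) * f x) \<in> borel_measurable lebesgue"
    using assms by (intro borel_measurable_times) auto
qed (simp add: norm_mult)

text \<open>
  Dominated convergence, with the modulus of \<open>f\<close> as majorant.
\<close>
lemma continuous_fourier_integral:
  fixes f :: "'a::euclidean_space \<Rightarrow> complex"
  assumes "integrable lebesgue f"
  shows "continuous_on UNIV (fourier_integral f)"
proof (rule continuous_at_imp_continuous_on, rule ballI, rule continuous_at_sequentiallyI)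
  fix \<xi> :: 'a and X :: "nat \<Rightarrow> 'a"
  assume X: "X \<longlonglongrightarrow> \<xi>"
  show "(\<lambda>n. fourier_integral f (X n)) \<longlonglongrightarrow> fourier_integral f \<xi>"
    unfolding fourier_integral_def
  proof (rule integral_dominated_convergence[where w = "\<lambda>x. norm (f x)"])
    show "AE x in lebesgue. (\<lambda>n. exp (- \<i> * of_real (x \<bullet> X n)) * f x)
            \<longlonglongrightarrow> exp (- \<i> * of_real (x \<bullet> \<xi>)) * f x"
      by (intro AE_I2 tendsto_intros X)
  qed (use assms integrable_fourier_integrand[OF assms] in \<open>auto simp: norm_mult\<close>)
qed

lemma borel_measurable_fourier_integral:
  fixes f :: "'a::euclidean_space \<Rightarrow> complex"
  assumes "integrable lebesgue f"
  shows "fourier_integral f \<in> borel_measurable lebesgue"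
  using borel_measurable_continuous_onI[OF continuous_fourier_integral[OF assms]]
  by (intro measurable_completion) simp

text \<open>
  On a ball, \<open>|f| \<le> 1 + |f|\<^sup>2\<close> gives an integrable majorant.
\<close>
lemma integrable_truncation:
  fixes f :: "'a::euclidean_space \<Rightarrow> complex"
  assumes "in_L2 f"
  shows "integrable lebesgue (\<lambda>x. indicator (cball 0 R) x *\<^sub>R f x)"
proof (rule Bochner_Integration.integrable_bound)
  have f: "f \<in> borel_measurable lebesgue" "integrable lebesgue (\<lambda>x. (norm (f x))\<^sup>2)"
    using assms by (auto simp: in_L2_on_def lebesgue_on_UNIV_eq)
  have "integrable lebesgue (indicator (cball 0 R) :: 'a \<Rightarrow> real)"
    by (rule integrable_real_indicator) (use emeasure_lborel_cball_finite[of "0::'a" R] in auto)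
  then show "integrable lebesgue (\<lambda>x. indicator (cball 0 R) x + (norm (f x))\<^sup>2)"
    using f(2) by (rule Bochner_Integration.integrable_add)
  show "(\<lambda>x. indicator (cball 0 R) x *\<^sub>R f x) \<in> borel_measurable lebesgue"
    using f(1) by (intro borel_measurable_scaleR borel_measurable_indicator) auto
  have "y \<le> 1 + y\<^sup>2" for y :: real
    using zero_le_power2[of "y - 1/2"] by (simp add: power2_diff power2_eq_square algebra_simps)
  then show "AE x in lebesgue. norm (indicator (cball 0 R) x *\<^sub>R f x) \<le> norm (indicator (cball 0 R) x + (norm (f x))\<^sup>2)"
    by (auto simp: indicator_def)
qed

text \<open>
  Both limits are close to the same \<open>f s\<close>, and
  \<open>|g - h|\<^sup>2 \<le> 2 |f s - g|\<^sup>2 + 2 |f s - h|\<^sup>2\<close>.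
\<close>
lemma L2_tendsto_unique:
  fixes g h :: "'a::euclidean_space \<Rightarrow> complex"
  assumes g: "L2_tendsto f g F" and h: "L2_tendsto f h F" and F: "F \<noteq> bot"
    and meas: "\<And>s. f s \<in> borel_measurable lebesgue" "g \<in> borel_measurable lebesgue" "h \<in> borel_measurable lebesgue"
  shows "AE x in lebesgue. g x = h x"
proof -
  let ?d = "\<lambda>g s. \<integral>\<^sup>+x. ennreal ((norm (f s x - g x))\<^sup>2) \<partial>lebesgue"
  have le: "(\<integral>\<^sup>+x. ennreal ((norm (g x - h x))\<^sup>2) \<partial>lebesgue) \<le> 2 * ?d g s + 2 * ?d h s" for s
  proof -
    have "(\<integral>\<^sup>+x. ennreal ((norm (g x - h x))\<^sup>2) \<partial>lebesgue)
        \<le> (\<integral>\<^sup>+x. 2 * ennreal ((norm (f s x - g x))\<^sup>2) + 2 * ennreal ((norm (f s x - h x))\<^sup>2) \<partial>lebesgue)"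
    proof (rule nn_integral_mono)
      fix x
      have "norm (g x - h x) \<le> norm (f s x - g x) + norm (f s x - h x)"
        using norm_triangle_ineq4[of "f s x - h x" "f s x - g x"] by simp
      then have "(norm (g x - h x))\<^sup>2 \<le> (norm (f s x - g x) + norm (f s x - h x))\<^sup>2"
        by (intro power_mono) auto
      also have "\<dots> \<le> 2 * (norm (f s x - g x))\<^sup>2 + 2 * (norm (f s x - h x))\<^sup>2"
        using sum_squares_bound[of "norm (f s x - g x)" "norm (f s x - h x)"] by (simp add: power2_sum)
      finally have "ennreal ((norm (g x - h x))\<^sup>2) \<le> ennreal (2 * (norm (f s x - g x))\<^sup>2 + 2 * (norm (f s x - h x))\<^sup>2)"
        by (rule ennreal_leI)
      then show "ennreal ((norm (g x - h x))\<^sup>2) \<le> 2 * ennreal ((norm (f s x - g x))\<^sup>2) + 2 * ennreal ((norm (f s x - h x))\<^sup>2)"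
        by (simp add: ennreal_mult)
    qed
    also have "\<dots> = 2 * ?d g s + 2 * ?d h s"
      using meas by (subst nn_integral_add) (auto simp: nn_integral_cmult)
    finally show ?thesis .
  qed
  have "((\<lambda>s. 2 * ?d g s + 2 * ?d h s) \<longlongrightarrow> 2 * 0 + 2 * 0) F"
    using g h unfolding L2_tendsto_def by (intro tendsto_add ennreal_tendsto_cmult) auto
  then have "(\<integral>\<^sup>+x. ennreal ((norm (g x - h x))\<^sup>2) \<partial>lebesgue) \<le> 2 * 0 + 2 * 0"
    by (rule tendsto_lowerbound[OF _ always_eventually F]) (use le in auto)
  then have "(\<integral>\<^sup>+x. ennreal ((norm (g x - h x))\<^sup>2) \<partial>lebesgue) = 0"
    by simp
  then show ?thesis
    using meas by (subst (asm) nn_integral_0_iff_AE) auto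
qed

text \<open>
  By Fatou's lemma the \<open>L\<^sup>2\<close> distance of the two limits is at most the lower limit of the
  distances of \<open>f n\<close> and \<open>g\<close>, that is, zero.
\<close>
lemma L2_tendsto_pointwise_unique:
  fixes g h :: "'a::euclidean_space \<Rightarrow> complex"
  assumes g: "L2_tendsto f g sequentially" and h: "\<And>x. (\<lambda>n. f n x) \<longlonglongrightarrow> h x"
    and meas: "\<And>n. f n \<in> borel_measurable lebesgue" "g \<in> borel_measurable lebesgue" "h \<in> borel_measurable lebesgue"
  shows "AE x in lebesgue. g x = h x"
proof -
  have lim: "(\<lambda>n. ennreal ((norm (f n x - g x))\<^sup>2)) \<longlonglongrightarrow> ennreal ((norm (h x - g x))\<^sup>2)" for x
    by (intro tendsto_ennrealI tendsto_intros h)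
  have "(\<integral>\<^sup>+x. ennreal ((norm (h x - g x))\<^sup>2) \<partial>lebesgue)
      = (\<integral>\<^sup>+x. liminf (\<lambda>n. ennreal ((norm (f n x - g x))\<^sup>2)) \<partial>lebesgue)"
    by (intro nn_integral_cong lim_imp_Liminf[symmetric] lim) auto
  also have "\<dots> \<le> liminf (\<lambda>n. \<integral>\<^sup>+x. ennreal ((norm (f n x - g x))\<^sup>2) \<partial>lebesgue)"
    using meas by (intro nn_integral_liminf) auto
  also have "\<dots> = 0"
    using g unfolding L2_tendsto_def by (intro lim_imp_Liminf) auto
  finally have "(\<integral>\<^sup>+x. ennreal ((norm (h x - g x))\<^sup>2) \<partial>lebesgue) = 0"
    by simp
  then show ?thesis
    using meas by (subst (asm) nn_integral_0_iff_AE) (auto elim: eventually_mono)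
qed

lemma has_fourier_unique:
  assumes "has_fourier f g" "has_fourier f h"
  shows "AE \<xi> in lebesgue. g \<xi> = h \<xi>"
proof (rule L2_tendsto_unique)
  show "fourier_integral (\<lambda>x. indicator (cball 0 R) x *\<^sub>R f x) \<in> borel_measurable lebesgue" for R
    using assms by (intro borel_measurable_fourier_integral integrable_truncation) (simp add: has_fourier_def)
qed (use assms in \<open>auto simp: has_fourier_def in_L2_on_def lebesgue_on_UNIV_eq\<close>)

text \<open>
  For integrable \<open>f\<close> the truncated Fourier integrals converge pointwise to the full one, by
  dominated convergence; so the \<open>L\<^sup>2\<close> limit is given by the Fourier integral, and pointwise bounds
  on the latter become available.
\<close>
lemma has_fourier_fourier_integral:
  assumes f: "in_L1 f" and g: "has_fourier f g"
  shows "AE \<xi> in lebesgue. g \<xi> = fourier_integral f \<xi>"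
proof (rule L2_tendsto_pointwise_unique)
  let ?f = "\<lambda>n x. indicator (cball 0 (real n)) x *\<^sub>R f x"
  have int: "integrable lebesgue f" using f by (simp add: in_L1_def)
  have int': "integrable lebesgue (?f n)" for n
    using g by (intro integrable_truncation) (simp add: has_fourier_def)
  show "L2_tendsto (\<lambda>n. fourier_integral (?f n)) g sequentially"
    using filterlim_compose[OF _ filterlim_real_sequentially] g
    unfolding has_fourier_def L2_tendsto_def by fast
  show "(\<lambda>n. fourier_integral (?f n) \<xi>) \<longlonglongrightarrow> fourier_integral f \<xi>" for \<xi>
    unfolding fourier_integral_def
  proof (rule integral_dominated_convergence[where w = "\<lambda>x. norm (f x)"])
    show "AE x in lebesgue. (\<lambda>n. exp (- \<i> * of_real (x \<bullet> \<xi>)) * ?f n x) \<longlonglongrightarrow> exp (- \<i> * of_real (x \<bullet> \<xi>)) * f x"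
    proof (intro AE_I2 tendsto_eventually)
      fix x
      show "\<forall>\<^sub>F n in sequentially. exp (- \<i> * of_real (x \<bullet> \<xi>)) * ?f n x = exp (- \<i> * of_real (x \<bullet> \<xi>)) * f x"
        using eventually_ge_at_top[of "nat \<lceil>norm x\<rceil>"]
        by eventually_elim (auto simp: indicator_def; linarith)
    qed
  qed (use int integrable_fourier_integrand[OF int] integrable_fourier_integrand[OF int'] in
        \<open>auto simp: norm_mult indicator_def\<close>)
  show "fourier_integral (?f n) \<in> borel_measurable lebesgue" for n
    by (intro borel_measurable_fourier_integral int')
  show "fourier_integral f \<in> borel_measurable lebesgue"
    by (intro borel_measurable_fourier_integral int)
qed (use g in \<open>auto simp: has_fourier_def in_L2_on_def lebesgue_on_UNIV_eq\<close>)

text \<open>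
  The initial data are attained only almost everywhere, so the transforms have to be carried
  over from \<open>u 0\<close> and \<open>v 0\<close> to the data themselves.
\<close>
lemma has_fourier_cong_AE:
  fixes f :: "'a::euclidean_space \<Rightarrow> complex"
  assumes ae: "AE x in lebesgue. f x = f' x" and f: "has_fourier f g" and f': "in_L2 f'"
  shows "has_fourier f' g"
proof -
  have "fourier_integral (\<lambda>x. indicator (cball 0 R) x *\<^sub>R f x) = fourier_integral (\<lambda>x. indicator (cball 0 R) x *\<^sub>R f' x)" for R
  proof
    fix \<xi> :: 'a
    have meas: "(\<lambda>x. exp (- \<i> * of_real (x \<bullet> \<xi>)) * (indicator (cball 0 R) x *\<^sub>R h x)) \<in> borel_measurable lebesgue"
      if "in_L2 h" for h
      using integrable_fourier_integrand[OF integrable_truncation[OF that]] by auto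
    show "fourier_integral (\<lambda>x. indicator (cball 0 R) x *\<^sub>R f x) \<xi> = fourier_integral (\<lambda>x. indicator (cball 0 R) x *\<^sub>R f' x) \<xi>"
      unfolding fourier_integral_def
    proof (rule integral_cong_AE[OF meas meas])
      show "AE x in lebesgue. exp (- \<i> * of_real (x \<bullet> \<xi>)) * (indicator (cball 0 R) x *\<^sub>R f x)
              = exp (- \<i> * of_real (x \<bullet> \<xi>)) * (indicator (cball 0 R) x *\<^sub>R f' x)"
        using ae by eventually_elim simp
    qed (use f f' in \<open>auto simp: has_fourier_def\<close>)
  qed
  then show ?thesis using f f' by (simp add: has_fourier_def)
qed

lemma norm_fourier_integral_le:
  "norm (fourier_integral f \<xi>) \<le> L1_norm f"
  unfolding fourier_integral_def L1_norm_def
  by (rule order_trans[OF integral_norm_bound]) (simp add: norm_mult)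

text \<open>
  The integral of \<open>f\<close> is the Fourier integral at \<open>0\<close>, and
  \<open>|exp (- \<i> x \<bullet> \<xi>) - 1| \<le> |x| |\<xi>|\<close>: the weight in the norm pays for a factor \<open>|\<xi>|\<close>.
\<close>
lemma norm_fourier_integral_diff_le:
  fixes f :: "'a::euclidean_space \<Rightarrow> complex"
  assumes "in_L11 f"
  shows "norm (fourier_integral f \<xi> - (\<integral>x. f x \<partial>lebesgue)) \<le> norm \<xi> * L11_norm f"
proof -
  have int: "integrable lebesgue f" "integrable lebesgue (\<lambda>x. (1 + norm x) * norm (f x))"
    using assms by (auto simp: in_L11_def in_L1_def)
  have "norm (fourier_integral f \<xi> - (\<integral>x. f x \<partial>lebesgue))
      = norm (\<integral>x. exp (- \<i> * of_real (x \<bullet> \<xi>)) * f x - f x \<partial>lebesgue)"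
    unfolding fourier_integral_def
    by (subst Bochner_Integration.integral_diff) (use int integrable_fourier_integrand in auto)
  also have "\<dots> \<le> (\<integral>x. norm \<xi> * ((1 + norm x) * norm (f x)) \<partial>lebesgue)"
  proof (rule order_trans[OF integral_norm_bound integral_mono'])
    fix x
    have "norm (exp (- \<i> * of_real (x \<bullet> \<xi>)) - 1) \<le> norm (- \<i> * of_real (x \<bullet> \<xi>))"
      using norm_exp_diff_le[of "- \<i> * of_real (x \<bullet> \<xi>)" 0 0] by simp
    also have "\<dots> \<le> norm x * norm \<xi>" by (simp add: norm_mult Cauchy_Schwarz_ineq2)
    also have "\<dots> \<le> norm \<xi> * (1 + norm x)" by (simp add: algebra_simps)
    finally have "norm (exp (- \<i> * of_real (x \<bullet> \<xi>)) - 1) * norm (f x) \<le> norm \<xi> * (1 + norm x) * norm (f x)"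
      by (rule mult_right_mono) simp
    then show "norm (exp (- \<i> * of_real (x \<bullet> \<xi>)) * f x - f x) \<le> norm \<xi> * ((1 + norm x) * norm (f x))"
      by (simp add: mult.assoc left_diff_distrib flip: norm_mult)
  qed (use int in auto)
  finally show ?thesis by (simp add: L11_norm_def)
qed

section \<open>$L^2$ bounds from pointwise bounds\<close>

text \<open>
  Turns a pointwise majorant for the square into membership in \<open>L\<^sup>2(S)\<close> together with a norm bound.
  Both halves of the theorem use the same majorant, with \<open>s = t\<close> for low and \<open>s = 1\<close> for high
  frequencies.
\<close>
lemma L2_norm_on_le_radial:
  fixes f :: "'a::euclidean_space \<Rightarrow> complex"
  assumes S: "S \<in> sets lebesgue"
    and f: "f \<in> borel_measurable (lebesgue_on S)"
    and W: "(\<integral>\<^sup>+x. ennreal (1 / (1 + s * norm x) ^ m) \<partial>(lebesgue :: 'a measure)) \<le> ennreal V"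
    and B: "B \<ge> 0" and V: "V \<ge> 0" and s: "s \<ge> 0"
    and bound: "AE x in lebesgue. x \<in> S \<longrightarrow> (norm (f x))\<^sup>2 \<le> B\<^sup>2 * (1 / (1 + s * norm x) ^ m)"
  shows "in_L2_on S f \<and> L2_norm_on S f \<le> B * sqrt V"
proof -
  have "(\<integral>\<^sup>+x. ennreal ((norm (f x))\<^sup>2) \<partial>lebesgue_on S)
      \<le> (\<integral>\<^sup>+x. ennreal (B\<^sup>2) * ennreal (1 / (1 + s * norm x) ^ m) \<partial>lebesgue_on S)"
  proof (rule nn_integral_mono_AE)
    show "AE x in lebesgue_on S. ennreal ((norm (f x))\<^sup>2) \<le> ennreal (B\<^sup>2) * ennreal (1 / (1 + s * norm x) ^ m)"
      using bound s S by (auto simp: AE_restrict_space_iff simp flip: ennreal_mult elim!: eventually_mono intro!: ennreal_leI)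
  qed
  also have "\<dots> = (\<integral>\<^sup>+x. ennreal (B\<^sup>2) * ennreal (1 / (1 + s * norm x) ^ m) * indicator S x \<partial>lebesgue)"
    using S by (intro nn_integral_restrict_space) simp
  also have "\<dots> \<le> (\<integral>\<^sup>+x. ennreal (B\<^sup>2) * ennreal (1 / (1 + s * norm x) ^ m) \<partial>(lebesgue :: 'a measure))"
    by (rule nn_integral_mono) (auto split: split_indicator)
  also have "\<dots> = ennreal (B\<^sup>2) * (\<integral>\<^sup>+x. ennreal (1 / (1 + s * norm x) ^ m) \<partial>(lebesgue :: 'a measure))"
  proof (rule nn_integral_cmult)
    have "(\<lambda>x::'a. ennreal (1 / (1 + s * norm x) ^ m)) \<in> borel_measurable borel" by measurable
    then show "(\<lambda>x::'a. ennreal (1 / (1 + s * norm x) ^ m)) \<in> borel_measurable lebesgue"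
      by (intro measurable_completion) simp
  qed
  also have "\<dots> \<le> ennreal (B\<^sup>2) * ennreal V"
    by (rule mult_left_mono[OF W]) simp
  finally have le: "(\<integral>\<^sup>+x. ennreal ((norm (f x))\<^sup>2) \<partial>lebesgue_on S) \<le> ennreal (B\<^sup>2 * V)"
    using V by (simp add: ennreal_mult)
  have int: "integrable (lebesgue_on S) (\<lambda>x. (norm (f x))\<^sup>2)"
    by (rule integrableI_nonneg) (use f le in \<open>auto intro: le_less_trans\<close>)
  have "ennreal (\<integral>x. (norm (f x))\<^sup>2 \<partial>lebesgue_on S) \<le> ennreal (B\<^sup>2 * V)"
    using le by (subst (asm) nn_integral_eq_integral[OF int]) auto
  then have "(\<integral>x. (norm (f x))\<^sup>2 \<partial>lebesgue_on S) \<le> B\<^sup>2 * V"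
    using V by simp
  then have "L2_norm_on S f \<le> sqrt (B\<^sup>2 * V)"
    unfolding L2_norm_on_def by (rule real_sqrt_le_mono)
  then show ?thesis
    using int f B by (simp add: in_L2_on_def real_sqrt_mult)
qed

section \<open>The solution on the Fourier side\<close>

text \<open>
  The representatives in the definition of a mild solution agree almost everywhere with the
  transform of \<open>u t\<close> and, at time zero, with the Fourier integrals of the data, so at almost every
  frequency the ordinary differential equation can be solved explicitly.  The roots are quantified
  inside, because their form depends on the side of the threshold on which \<open>\<xi>\<close> lies.
\<close>
lemma mild_solution_fourier:
  fixes u0 u1 :: "'a::euclidean_space \<Rightarrow> complex"
  assumes sol: "mild_solution \<mu> u0 u1 u" and t: "t \<ge> 0"
    and u0: "in_L1 u0" "in_L2 u0" and u1: "in_L1 u1" "in_L2 u1"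
  shows "in_L2 (fourier (u t)) \<and> (AE \<xi> in lebesgue. \<forall>l m.
      l + m = - of_real (\<mu> * ln (1 + norm \<xi>)) \<and> l * m = of_real ((norm \<xi>)\<^sup>2) \<and> l \<noteq> m \<longrightarrow>
      fourier (u t) \<xi> = fourier_integral u0 \<xi> * (exp (l * of_real t) - l * exp_divided_difference l m t)
                        + fourier_integral u1 \<xi> * exp_divided_difference l m t)"
proof -
  from sol obtain v w w' where
    init: "AE x in lebesgue. u 0 x = u0 x" "AE x in lebesgue. v 0 x = u1 x"
    and w: "\<And>t. t \<ge> 0 \<Longrightarrow> has_fourier (u t) (w t)" "\<And>t. t \<ge> 0 \<Longrightarrow> has_fourier (v t) (w' t)"
    and ode: "AE \<xi> in lebesgue. \<forall>t\<ge>0.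
        ((\<lambda>s. w s \<xi>) has_vector_derivative w' t \<xi>) (at t within {0..}) \<and>
        ((\<lambda>s. w' s \<xi>) has_vector_derivative
           - (of_real (\<mu> * L_symbol \<xi>) * w' t \<xi> + of_real ((norm \<xi>)\<^sup>2) * w t \<xi>))
          (at t within {0..})"
    unfolding mild_solution_def by blast
  have u: "has_fourier (u t) (fourier (u t))"
    unfolding fourier_def by (rule someI[where P = "has_fourier (u t)", OF w(1)[OF t]])
  have eqs: "AE \<xi> in lebesgue. fourier (u t) \<xi> = w t \<xi>"
     "AE \<xi> in lebesgue. w 0 \<xi> = fourier_integral u0 \<xi>"
     "AE \<xi> in lebesgue. w' 0 \<xi> = fourier_integral u1 \<xi>"
    using has_fourier_unique[OF u w(1)[OF t]]
      has_fourier_fourier_integral[OF u0(1) has_fourier_cong_AE[OF init(1) w(1) u0(2)]]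
      has_fourier_fourier_integral[OF u1(1) has_fourier_cong_AE[OF init(2) w(2) u1(2)]]
    by auto
  from eqs ode have "AE \<xi> in lebesgue. \<forall>l m.
      l + m = - of_real (\<mu> * ln (1 + norm \<xi>)) \<and> l * m = of_real ((norm \<xi>)\<^sup>2) \<and> l \<noteq> m \<longrightarrow>
      fourier (u t) \<xi> = fourier_integral u0 \<xi> * (exp (l * of_real t) - l * exp_divided_difference l m t)
                        + fourier_integral u1 \<xi> * exp_divided_difference l m t"
  proof eventually_elim
    case (elim \<xi>)
    show ?case
    proof (intro allI impI)
      fix l m :: complex
      assume "l + m = - of_real (\<mu> * ln (1 + norm \<xi>)) \<and> l * m = of_real ((norm \<xi>)\<^sup>2) \<and> l \<noteq> m"
      then show "fourier (u t) \<xi> = fourier_integral u0 \<xi> * (exp (l * of_real t) - l * exp_divided_difference l m t)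
                        + fourier_integral u1 \<xi> * exp_divided_difference l m t"
        using second_order_ode_solution[of "\<lambda>s. w s \<xi>" "\<lambda>s. w' s \<xi>"
            "of_real (\<mu> * ln (1 + norm \<xi>))" "of_real ((norm \<xi>)\<^sup>2)" l m t] elim t
        by (auto simp: L_symbol_def)
    qed
  qed
  with u show ?thesis by (simp add: has_fourier_def)
qed

text \<open>
  Subtracting the profile replaces the coefficient \<open>a1\<close> of the divided difference \<open>D\<close> by \<open>a1 - P\<close>,
  which is of size \<open>r\<close>; the contribution of \<open>a0\<close> contains \<open>D\<close> only with the factor \<open>l\<close>, again of
  size \<open>r\<close>.  Since \<open>|D| \<le> t exp (- r t / \<mu>)\<close>, all that remains is a function of \<open>r t\<close> alone.
\<close>
lemma low_frequency_remainder_bound: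
  fixes a0 a1 P :: complex
  assumes \<mu>: "\<mu> > 2" and r: "r > 0" "2 * r < \<mu> * ln (1 + r)" and t: "t \<ge> 0"
    and a0: "norm a0 \<le> N" and a1: "norm (a1 - P) \<le> r * N"
    and v: "\<And>l m. l + m = - of_real (\<mu> * ln (1 + r)) \<Longrightarrow> l * m = of_real (r\<^sup>2) \<Longrightarrow> l \<noteq> m \<Longrightarrow>
      v = a0 * (exp (l * of_real t) - l * exp_divided_difference l m t) + a1 * exp_divided_difference l m t"
    and z: "norm \<xi> = r"
  shows "norm (v - nu \<mu> P t \<xi>) \<le> 2 * N * (1 + r * t) * exp (- (r * t) / \<mu>)"
proof -
  note lam = lambda_low_frequency[OF \<mu> r]
  define l m where "l = complex_of_real (lambda_plus \<mu> r)" and "m = complex_of_real (lambda_minus \<mu> r)"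
  define D where "D = exp_divided_difference l m t"
  have N: "N \<ge> 0" using order_trans[OF norm_ge_zero a0] .
  have E: "norm (exp (l * of_real t)) \<le> exp (- (r * t) / \<mu>)"
    using mult_right_mono[OF lam(5) t] by (simp add: l_def)
  have "norm D \<le> t * exp (- r / \<mu> * t)"
    unfolding D_def by (rule norm_exp_divided_difference_le) (use lam t in \<open>auto simp: l_def m_def\<close>)
  then have D: "norm D \<le> t * exp (- (r * t) / \<mu>)" by simp
  have nu: "nu \<mu> P t \<xi> = P * D"
    unfolding D_def exp_divided_difference_def l_def m_def nu_def Let_def z lam(3)[symmetric]
    by (simp add: exp_of_real flip: of_real_mult)
  have "v = a0 * (exp (l * of_real t) - l * D) + a1 * D"
    unfolding D_def
    by (rule v) (use lam(1,2,4) in \<open>auto simp: l_def m_def simp flip: of_real_add of_real_mult of_real_minus\<close>)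
  then have "v - nu \<mu> P t \<xi> = a0 * (exp (l * of_real t) - l * D) + (a1 - P) * D"
    unfolding nu by (simp add: algebra_simps)
  also have "norm \<dots> \<le> norm a0 * (norm (exp (l * of_real t)) + norm l * norm D) + norm (a1 - P) * norm D"
    by (intro norm_triangle_mono order_refl order_trans[OF norm_triangle_ineq4])
       (auto simp: norm_mult intro!: mult_left_mono order_trans[OF norm_triangle_ineq4])
  also have "\<dots> \<le> N * (exp (- (r * t) / \<mu>) + r * (t * exp (- (r * t) / \<mu>))) + r * N * (t * exp (- (r * t) / \<mu>))"
    by (intro add_mono mult_mono a0 a1 D E) (use lam(6) r t N in \<open>auto simp: l_def\<close>)
  also have "\<dots> = N * (1 + 2 * (r * t)) * exp (- (r * t) / \<mu>)"
    by (simp add: algebra_simps)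
  also have "\<dots> \<le> N * (2 * (1 + r * t)) * exp (- (r * t) / \<mu>)"
    using N r t by (intro mult_right_mono mult_left_mono) auto
  finally show ?thesis by (simp add: mult_ac)
qed

text \<open>
  The explicit formula, with \<open>|l| = r\<close> and both exponentials of modulus
  \<open>exp (- \<mu> t ln (1 + r) / 2)\<close>, the power \<open>- \<mu> t / 2\<close> of \<open>1 + r\<close>.
\<close>
lemma high_frequency_bound:
  fixes a0 a1 v :: complex
  assumes \<mu>: "\<mu> > 0" and r: "r > 0" "\<mu> * ln (1 + r) < 2 * r" and t: "t \<ge> 0"
    and a0: "norm a0 \<le> N0" and a1: "norm a1 \<le> N1"
    and v: "\<And>l m. l + m = - of_real (\<mu> * ln (1 + r)) \<Longrightarrow> l * m = of_real (r\<^sup>2) \<Longrightarrow> l \<noteq> m \<Longrightarrow>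
      v = a0 * (exp (l * of_real t) - l * exp_divided_difference l m t) + a1 * exp_divided_difference l m t"
  shows "norm v \<le> (N0 + N1) * (1 + t) * (1 + r) * exp (- (\<mu> * t * ln (1 + r) / 2))"
proof -
  obtain l m where lm: "l + m = - complex_of_real (\<mu> * ln (1 + r))" "l * m = of_real (r\<^sup>2)" "l \<noteq> m"
    "Re l = - (\<mu> * ln (1 + r) / 2)" "Re m = - (\<mu> * ln (1 + r) / 2)" "norm l = r"
    by (rule lambda_high_frequency[OF r \<mu>])
  define D where "D = exp_divided_difference l m t"
  define e where "e = exp (- (\<mu> * t * ln (1 + r) / 2))"
  have E: "norm (exp (l * of_real t)) = e" by (simp add: lm e_def)
  have "norm D \<le> t * exp (- (\<mu> * ln (1 + r) / 2) * t)"
    unfolding D_def by (rule norm_exp_divided_difference_le) (use lm t in auto)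
  then have D: "norm D \<le> t * e" by (simp add: e_def mult_ac)
  have N: "N0 \<ge> 0" "N1 \<ge> 0" using a0 a1 norm_ge_zero order_trans by blast+
  have "v = a0 * (exp (l * of_real t) - l * D) + a1 * D"
    unfolding D_def by (rule v) (use lm in auto)
  also have "norm \<dots> \<le> norm a0 * (norm (exp (l * of_real t)) + norm l * norm D) + norm a1 * norm D"
    by (intro norm_triangle_mono order_refl order_trans[OF norm_triangle_ineq4])
       (auto simp: norm_mult intro!: mult_left_mono order_trans[OF norm_triangle_ineq4])
  also have "\<dots> \<le> N0 * (e + r * (t * e)) + N1 * (t * e)"
    by (intro add_mono mult_mono a0 a1 D) (use E lm r t N in auto)
  also have "\<dots> = (N0 * (1 + r * t) + N1 * t) * e"
    by (simp add: algebra_simps)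
  also have "\<dots> \<le> (N0 * ((1 + t) * (1 + r)) + N1 * ((1 + t) * (1 + r))) * e"
    using r t N by (intro mult_right_mono add_mono mult_left_mono) (auto simp: e_def algebra_simps)
  finally show ?thesis by (simp add: e_def algebra_simps)
qed

section \<open>Estimates in $L^2$\<close>

text \<open>
  The square of the pointwise bound is a power of \<open>1 + r t\<close> times \<open>exp (- 2 r t / \<mu>)\<close>, hence at
  most a multiple of \<open>1 / (1 + r t) ^ (n + 2)\<close>, whose integral scales like \<open>t ^ - n\<close>.
\<close>
lemma low_frequency_estimate:
  fixes \<mu> \<delta> :: real
  assumes \<mu>: "\<mu> > 2" and \<delta>: "\<And>r. 0 < r \<Longrightarrow> r < \<delta> \<Longrightarrow> 2 * r < \<mu> * ln (1 + r)"
  obtains C where "C > 0"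
    "\<And>(u0 :: 'a::euclidean_space \<Rightarrow> complex) u1 u t.
      in_L1 u0 \<Longrightarrow> in_L2 u0 \<Longrightarrow> in_L11 u1 \<Longrightarrow> in_L2 u1 \<Longrightarrow> mild_solution \<mu> u0 u1 u \<Longrightarrow> t > 0 \<Longrightarrow>
      in_L2_on {\<xi>. norm \<xi> \<le> \<delta>} (\<lambda>\<xi>. fourier (u t) \<xi> - nu \<mu> (\<integral>x. u1 x \<partial>lebesgue) t \<xi>) \<and>
      L2_norm_on {\<xi>. norm \<xi> \<le> \<delta>} (\<lambda>\<xi>. fourier (u t) \<xi> - nu \<mu> (\<integral>x. u1 x \<partial>lebesgue) t \<xi>)
        \<le> C * (L1_norm u0 + L11_norm u1) * t powr (- (DIM('a) / 2))"
proof -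
  let ?n = "DIM('a)"
  obtain W where W: "W > 0"
    "\<And>s. s > 0 \<Longrightarrow> (\<integral>\<^sup>+x. ennreal (1 / (1 + s * norm x) ^ (?n + 2)) \<partial>(lebesgue :: 'a measure)) \<le> ennreal (W / s ^ ?n)"
    by (rule nn_integral_radial_power_bound[where 'a = 'a]) blast
  obtain K where K: "K > 0" "\<And>y. y \<ge> 0 \<Longrightarrow> (1 + y) ^ (?n + 4) * exp (- (2 / \<mu>) * y) \<le> K"
    by (rule power_times_exp_bounded[of "2 / \<mu>" "?n + 4"]) (use \<mu> in auto)
  show ?thesis
  proof
    show "2 * sqrt K * sqrt W > 0" using K W by simp
    fix u0 u1 :: "'a \<Rightarrow> complex" and u t
    assume u0: "in_L1 u0" "in_L2 u0" and u1: "in_L11 u1" "in_L2 u1"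
      and sol: "mild_solution \<mu> u0 u1 u" and t: "(t::real) > 0"
    let ?P = "\<integral>x. u1 x \<partial>lebesgue" and ?S = "{\<xi>::'a. norm \<xi> \<le> \<delta>}"
    let ?D = "\<lambda>\<xi>. fourier (u t) \<xi> - nu \<mu> ?P t \<xi>"
    define N where "N = L1_norm u0 + L11_norm u1"
    have N: "L1_norm u0 \<le> N" "L11_norm u1 \<le> N" "N \<ge> 0"
      by (auto simp: N_def L1_norm_def L11_norm_def)
    have u1': "in_L1 u1" using u1 by (simp add: in_L11_def)
    note F = mild_solution_fourier[OF sol less_imp_le[OF t] u0 u1' u1(2)]
    have S: "?S \<in> sets lebesgue"
      using borel_closed[OF closed_cball[of "0::'a" \<delta>]] by (simp add: cball_def)
    have "nu \<mu> ?P t \<in> borel_measurable (borel :: 'a measure)"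
      unfolding nu_def[abs_def] lambda_plus_def lambda_minus_def Let_def by measurable
    then have nu: "nu \<mu> ?P t \<in> borel_measurable (lebesgue :: 'a measure)"
      by (intro measurable_completion) simp
    have D: "?D \<in> borel_measurable (lebesgue_on ?S)"
      using F nu by (intro measurable_restrict_space1 borel_measurable_diff) (auto simp: in_L2_on_def lebesgue_on_UNIV_eq)
    \<comment> \<open>The roots are known to be distinct for \<open>0 < |\<xi>| < \<delta>\<close> only; the two spheres that remain are null sets.\<close>
    have ae: "AE \<xi> in lebesgue. \<xi> \<notin> sphere (0::'a) 0 \<union> sphere 0 \<delta>"
      by (rule AE_not_in) (auto simp: negligible_iff_null_sets[symmetric] negligible_sphere)
    have "in_L2_on ?S ?D \<and> L2_norm_on ?S ?D \<le> (2 * N * sqrt K) * sqrt (W / t ^ ?n)"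
    proof (rule L2_norm_on_le_radial[OF S D W(2)[OF t]])
      show "AE \<xi> in lebesgue. \<xi> \<in> ?S \<longrightarrow> (norm (?D \<xi>))\<^sup>2 \<le> (2 * N * sqrt K)\<^sup>2 * (1 / (1 + t * norm \<xi>) ^ (?n + 2))"
        using F[THEN conjunct2] ae
      proof eventually_elim
        case (elim \<xi>)
        show ?case
        proof
          assume inS: "\<xi> \<in> ?S"
          define y where "y = norm \<xi> * t"
          have r: "0 < norm \<xi>" "norm \<xi> < \<delta>" using inS elim by auto
          then have y: "y \<ge> 0" using t by (simp add: y_def)
          have "norm (?D \<xi>) \<le> 2 * N * (1 + norm \<xi> * t) * exp (- (norm \<xi> * t) / \<mu>)"
          proof (rule low_frequency_remainder_bound[OF \<mu> r(1) \<delta>[OF r]])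
            show "norm (fourier_integral u0 \<xi>) \<le> N"
              using norm_fourier_integral_le N(1) order_trans by blast
            show "norm (fourier_integral u1 \<xi> - ?P) \<le> norm \<xi> * N"
              using norm_fourier_integral_diff_le[OF u1(1)] mult_left_mono[OF N(2) norm_ge_zero] order_trans by blast
          qed (use t elim(1) in auto)
          then have "(norm (?D \<xi>))\<^sup>2 \<le> (2 * N * (1 + y) * exp (- y / \<mu>))\<^sup>2"
            unfolding y_def by (intro power_mono) auto
          also have "\<dots> = (2 * N)\<^sup>2 * ((1 + y)\<^sup>2 * exp (- (2 / \<mu>) * y))"
          proof -
            have "(exp (- y / \<mu>))\<^sup>2 = exp (- (2 / \<mu>) * y)"
              unfolding exp_double[symmetric] by simp
            then show ?thesis by (simp only: power_mult_distrib mult.assoc)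
          qed
          also have "(1 + y)\<^sup>2 * exp (- (2 / \<mu>) * y) = (1 + y) ^ (?n + 4) * exp (- (2 / \<mu>) * y) / (1 + y) ^ (?n + 2)"
            using power_quotient[of "1 + y" ?n] y by (simp only: times_divide_eq_left[symmetric])
          also have "(2 * N)\<^sup>2 * \<dots> \<le> (2 * N)\<^sup>2 * (K / (1 + y) ^ (?n + 2))"
            by (intro mult_left_mono divide_right_mono K(2) y) (use y in auto)
          also have "\<dots> = (2 * N * sqrt K)\<^sup>2 * (1 / (1 + t * norm \<xi>) ^ (?n + 2))"
          proof -
            have "t * norm \<xi> = y" by (simp add: y_def)
            then show ?thesis using K(1) by (simp add: power_mult_distrib)
          qed
          finally show "(norm (?D \<xi>))\<^sup>2 \<le> (2 * N * sqrt K)\<^sup>2 * (1 / (1 + t * norm \<xi>) ^ (?n + 2))" .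
        qed
      qed
    qed (use N W K t in auto)
    moreover have "sqrt (W / t ^ ?n) = sqrt W * t powr (- (?n / 2))"
      by (simp only: real_sqrt_divide sqrt_power_eq_powr[OF t] powr_minus) (rule divide_inverse)
    ultimately show "in_L2_on ?S ?D \<and> L2_norm_on ?S ?D
        \<le> 2 * sqrt K * sqrt W * (L1_norm u0 + L11_norm u1) * t powr (- (?n / 2))"
      by (simp add: N_def mult_ac)
  qed
qed

text \<open>
  From the power \<open>- \<mu> t\<close> of \<open>1 + r\<close> in the square of the pointwise bound, the exponent
  \<open>- (n + 4)\<close> is spent on absorbing \<open>(1 + r)\<^sup>2\<close> and on integrability, which is possible as
  \<open>\<mu> t \<ge> n + 4\<close>; in the rest, \<open>r\<close> may be replaced by \<open>\<delta>\<close>.  As \<open>\<mu> ln (1 + \<delta>) = 2 \<delta>\<close>, that rest is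
  \<open>exp (- 2 \<delta> t)\<close> up to a constant.  One half of this rate absorbs \<open>(1 + t)\<^sup>2\<close>, and the
  square root halves the remaining rate \<open>\<delta>\<close>.
\<close>
lemma high_frequency_estimate:
  fixes \<mu> \<delta> :: real
  assumes \<mu>: "\<mu> > 2" and \<delta>: "\<delta> > 0" "\<mu> * ln (1 + \<delta>) = 2 * \<delta>"
    and high: "\<And>r. \<delta> < r \<Longrightarrow> \<mu> * ln (1 + r) < 2 * r"
  obtains C where "C > 0"
    "\<And>(u0 :: 'a::euclidean_space \<Rightarrow> complex) u1 u t.
      in_L1 u0 \<Longrightarrow> in_L2 u0 \<Longrightarrow> in_L1 u1 \<Longrightarrow> in_L2 u1 \<Longrightarrow> mild_solution \<mu> u0 u1 u \<Longrightarrow> t \<ge> real DIM('a) + 4 \<Longrightarrow>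
      in_L2_on {\<xi>. norm \<xi> \<ge> \<delta>} (fourier (u t)) \<and>
      L2_norm_on {\<xi>. norm \<xi> \<ge> \<delta>} (fourier (u t)) \<le> C * (L1_norm u0 + L1_norm u1) * exp (- (\<delta> / 2) * t)"
proof -
  let ?n = "DIM('a)"
  obtain W where W: "W > 0"
    "\<And>s. s > 0 \<Longrightarrow> (\<integral>\<^sup>+x. ennreal (1 / (1 + s * norm x) ^ (?n + 2)) \<partial>(lebesgue :: 'a measure)) \<le> ennreal (W / s ^ ?n)"
    by (rule nn_integral_radial_power_bound[where 'a = 'a]) blast
  have W1: "(\<integral>\<^sup>+x. ennreal (1 / (1 + 1 * norm x) ^ (?n + 2)) \<partial>(lebesgue :: 'a measure)) \<le> ennreal W"
    using W(2)[of 1] by simp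
  obtain K where K: "K > 0" "\<And>y. y \<ge> 0 \<Longrightarrow> (1 + y) ^ 2 * exp (- \<delta> * y) \<le> K"
    by (rule power_times_exp_bounded[of \<delta> 2]) (use \<delta> in auto)
  define M where "M = sqrt (K * (1 + \<delta>) ^ (?n + 4))"
  have M: "M > 0" "M\<^sup>2 = K * (1 + \<delta>) ^ (?n + 4)" using K(1) \<delta> by (auto simp: M_def)
  show ?thesis
  proof
    show "M * sqrt W > 0" using M W by simp
    fix u0 u1 :: "'a \<Rightarrow> complex" and u t
    assume u0: "in_L1 u0" "in_L2 u0" and u1: "in_L1 u1" "in_L2 u1"
      and sol: "mild_solution \<mu> u0 u1 u" and t: "t \<ge> real ?n + 4"
    let ?S = "{\<xi>::'a. norm \<xi> \<ge> \<delta>}"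
    define N where "N = L1_norm u0 + L1_norm u1"
    have N: "N \<ge> 0" by (auto simp: N_def L1_norm_def)
    have t0: "t \<ge> 0" using t by linarith
    note F = mild_solution_fourier[OF sol t0 u0 u1]
    have S: "?S \<in> sets lebesgue"
      using borel_open[OF open_ball[of "0::'a" \<delta>]] by (simp add: ball_def set_diff_eq not_less borel_comp Compl_eq)
    have D: "fourier (u t) \<in> borel_measurable (lebesgue_on ?S)"
      using F by (intro measurable_restrict_space1) (auto simp: in_L2_on_def lebesgue_on_UNIV_eq)
    \<comment> \<open>The characteristic roots coincide there.\<close>
    have ae: "AE \<xi> in lebesgue. \<xi> \<notin> sphere (0::'a) \<delta>"
      by (rule AE_not_in) (auto simp: negligible_iff_null_sets[symmetric] negligible_sphere)
    let ?B = "N * M * exp (- (\<delta> / 2) * t)"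
    have "in_L2_on ?S (fourier (u t)) \<and> L2_norm_on ?S (fourier (u t)) \<le> ?B * sqrt W"
    proof (rule L2_norm_on_le_radial[OF S D W1])
      show "AE \<xi> in lebesgue. \<xi> \<in> ?S \<longrightarrow> (norm (fourier (u t) \<xi>))\<^sup>2 \<le> ?B\<^sup>2 * (1 / (1 + 1 * norm \<xi>) ^ (?n + 2))"
        using F[THEN conjunct2] ae
      proof eventually_elim
        case (elim \<xi>)
        show ?case
        proof
          assume inS: "\<xi> \<in> ?S"
          define r where "r = norm \<xi>"
          have r: "\<delta> < r" "0 < r" using inS elim \<delta> by (auto simp: r_def)
          have "norm (fourier (u t) \<xi>) \<le> N * (1 + t) * (1 + r) * exp (- (\<mu> * t * ln (1 + r) / 2))"
            unfolding N_def
            by (rule high_frequency_bound[OF _ r(2) high[OF r(1)] t0 norm_fourier_integral_le norm_fourier_integral_le])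
               (use \<mu> elim(1) in \<open>auto simp: r_def\<close>)
          then have "(norm (fourier (u t) \<xi>))\<^sup>2 \<le> (N * (1 + t) * (1 + r) * exp (- (\<mu> * t * ln (1 + r) / 2)))\<^sup>2"
            by (intro power_mono) auto
          also have "\<dots> = N\<^sup>2 * (1 + t)\<^sup>2 * (1 + r)\<^sup>2 * exp (- (\<mu> * t * ln (1 + r)))"
          proof -
            have "(exp (- (\<mu> * t * ln (1 + r) / 2)))\<^sup>2 = exp (- (\<mu> * t * ln (1 + r)))"
              unfolding exp_double[symmetric] by simp
            then show ?thesis by (simp only: power_mult_distrib)
          qed
          also have "\<dots> \<le> N\<^sup>2 * (1 + t)\<^sup>2 * (1 + r)\<^sup>2 * ((1 + \<delta>) ^ (?n + 4) * exp (- (2 * \<delta> * t)) / (1 + r) ^ (?n + 4))"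
          proof (rule mult_left_mono)
            have "1 * t \<le> \<mu> * t" using \<mu> t0 by (intro mult_right_mono) auto
            then have "\<mu> * t - (?n + 4) \<ge> 0" using t by linarith
            then have "(\<mu> * t - (?n + 4)) * ln (1 + \<delta>) \<le> (\<mu> * t - (?n + 4)) * ln (1 + r)"
              using r \<delta> by (intro mult_left_mono) auto
            moreover have "\<mu> * t * ln (1 + \<delta>) = 2 * \<delta> * t"
              using \<delta>(2) by (simp add: mult_ac)
            ultimately have "- (\<mu> * t * ln (1 + r)) \<le> (?n + 4) * ln (1 + \<delta>) - 2 * \<delta> * t - (?n + 4) * ln (1 + r)"
              unfolding left_diff_distrib by linarith
            then have "exp (- (\<mu> * t * ln (1 + r))) \<le> exp ((?n + 4) * ln (1 + \<delta>) - 2 * \<delta> * t - (?n + 4) * ln (1 + r))"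
              by simp
            also have "\<dots> = exp (real (?n + 4) * ln (1 + \<delta>)) * exp (- (2 * \<delta> * t)) / exp (real (?n + 4) * ln (1 + r))"
              by (simp add: exp_diff exp_minus divide_inverse)
            also have "\<dots> = (1 + \<delta>) ^ (?n + 4) * exp (- (2 * \<delta> * t)) / (1 + r) ^ (?n + 4)"
              unfolding exp_of_nat_mult using r \<delta> by simp
            finally show "exp (- (\<mu> * t * ln (1 + r))) \<le> (1 + \<delta>) ^ (?n + 4) * exp (- (2 * \<delta> * t)) / (1 + r) ^ (?n + 4)" .
          qed simp
          also have "\<dots> = N\<^sup>2 * (1 + \<delta>) ^ (?n + 4) * ((1 + t)\<^sup>2 * exp (- \<delta> * t)) * exp (- \<delta> * t) * (1 / (1 + r) ^ (?n + 2))"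
          proof -
            have "exp (- (2 * \<delta> * t)) = exp (- \<delta> * t) * exp (- \<delta> * t)" by (simp flip: exp_add)
            moreover have "(1 + r)\<^sup>2 / (1 + r) ^ (?n + 4) = 1 / (1 + r) ^ (?n + 2)"
              using power_quotient[of "1 + r" ?n] r by (simp add: field_simps)
            ultimately show ?thesis by (simp add: divide_inverse mult_ac)
          qed
          also have "\<dots> \<le> N\<^sup>2 * (1 + \<delta>) ^ (?n + 4) * K * exp (- \<delta> * t) * (1 / (1 + r) ^ (?n + 2))"
            by (intro mult_left_mono mult_right_mono K(2) t0) (use \<delta> r in auto)
          also have "\<dots> = ?B\<^sup>2 * (1 / (1 + 1 * norm \<xi>) ^ (?n + 2))"
          proof -
            have "(exp (- (\<delta> / 2) * t))\<^sup>2 = exp (- \<delta> * t)"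
              unfolding exp_double[symmetric] by simp
            then show ?thesis by (simp add: power_mult_distrib M(2) r_def)
          qed
          finally show "(norm (fourier (u t) \<xi>))\<^sup>2 \<le> ?B\<^sup>2 * (1 / (1 + 1 * norm \<xi>) ^ (?n + 2))" .
        qed
      qed
    qed (use N M W in auto)
    then show "in_L2_on ?S (fourier (u t)) \<and> L2_norm_on ?S (fourier (u t))
        \<le> M * sqrt W * (L1_norm u0 + L1_norm u1) * exp (- (\<delta> / 2) * t)"
      by (simp add: N_def mult_ac)
  qed
qed

theorem theorem1p3:
  fixes \<mu> \<delta> :: real
  assumes "\<mu> > 2"
    and "\<delta> > 0" and "\<mu> * ln (1 + \<delta>) - 2 * \<delta> = 0"
  shows "\<exists>C>0. \<exists>\<alpha>>0.
    \<forall>(u0 :: real ^ 'n \<Rightarrow> complex) (u1 :: real ^ 'n \<Rightarrow> complex) (u :: real \<Rightarrow> real ^ 'n \<Rightarrow> complex).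
      in_H1 u0 \<and> in_L1 u0 \<and> in_L2 u1 \<and> in_L11 u1 \<and> mild_solution \<mu> u0 u1 u \<longrightarrow>
      (\<forall>\<^sub>F t in at_top.
        (let P1 = (\<integral>x. u1 x \<partial>lebesgue); D = (\<lambda>\<xi>. fourier (u t) \<xi> - nu \<mu> P1 t \<xi>) in
          in_L2_on {\<xi>. norm \<xi> \<le> \<delta>} D \<and>
          L2_norm_on {\<xi>. norm \<xi> \<le> \<delta>} D
            \<le> C * (L2_norm u0 + L1_norm u0 + L2_norm u1 + L11_norm u1)
                * t powr (- (real CARD('n) / 2))) \<and>
        in_L2_on {\<xi>. norm \<xi> \<ge> \<delta>} (fourier (u t)) \<and>
        L2_norm_on {\<xi>. norm \<xi> \<ge> \<delta>} (fourier (u t))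
          \<le> C * (L1_norm u0 + L1_norm u1) * exp (- \<alpha> * t))"
proof -
  obtain \<delta>' where \<delta>': "\<delta>' > 0" "\<mu> * ln (1 + \<delta>') - 2 * \<delta>' = 0"
    "\<And>r. 0 < r \<Longrightarrow> r < \<delta>' \<Longrightarrow> \<mu> * ln (1 + r) - 2 * r > 0"
    "\<And>r. \<delta>' < r \<Longrightarrow> \<mu> * ln (1 + r) - 2 * r < 0"
    by (rule threshold_exists[OF assms(1)]) blast
  have "\<delta>' = \<delta>"
    using threshold_ex1[OF assms(1)] \<delta>'(1,2) assms(2,3) by blast
  then have sign: "2 * r < \<mu> * ln (1 + r)" if "0 < r" "r < \<delta>" for r
    using \<delta>'(3)[of r] that by simp
  have sign': "\<mu> * ln (1 + r) < 2 * r" if "\<delta> < r" for r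
    using \<delta>'(4)[of r] \<open>\<delta>' = \<delta>\<close> that by simp
  obtain C1 where C1: "C1 > 0" "\<And>(u0 :: real ^ 'n \<Rightarrow> complex) u1 u t.
      in_L1 u0 \<Longrightarrow> in_L2 u0 \<Longrightarrow> in_L11 u1 \<Longrightarrow> in_L2 u1 \<Longrightarrow> mild_solution \<mu> u0 u1 u \<Longrightarrow> t > 0 \<Longrightarrow>
      in_L2_on {\<xi>. norm \<xi> \<le> \<delta>} (\<lambda>\<xi>. fourier (u t) \<xi> - nu \<mu> (\<integral>x. u1 x \<partial>lebesgue) t \<xi>) \<and>
      L2_norm_on {\<xi>. norm \<xi> \<le> \<delta>} (\<lambda>\<xi>. fourier (u t) \<xi> - nu \<mu> (\<integral>x. u1 x \<partial>lebesgue) t \<xi>)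
        \<le> C1 * (L1_norm u0 + L11_norm u1) * t powr (- (DIM(real ^ 'n) / 2))"
    using low_frequency_estimate[where 'a = "real ^ 'n" and \<delta> = \<delta>, OF assms(1)] sign by blast
  have \<delta>_eq: "\<mu> * ln (1 + \<delta>) = 2 * \<delta>" using assms(3) by simp
  obtain C2 where C2: "C2 > 0" "\<And>(u0 :: real ^ 'n \<Rightarrow> complex) u1 u t.
      in_L1 u0 \<Longrightarrow> in_L2 u0 \<Longrightarrow> in_L1 u1 \<Longrightarrow> in_L2 u1 \<Longrightarrow> mild_solution \<mu> u0 u1 u \<Longrightarrow> t \<ge> real DIM(real ^ 'n) + 4 \<Longrightarrow>
      in_L2_on {\<xi>. norm \<xi> \<ge> \<delta>} (fourier (u t)) \<and>
      L2_norm_on {\<xi>. norm \<xi> \<ge> \<delta>} (fourier (u t)) \<le> C2 * (L1_norm u0 + L1_norm u1) * exp (- (\<delta> / 2) * t)"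
    using high_frequency_estimate[where 'a = "real ^ 'n" and \<delta> = \<delta>, OF assms(1,2) \<delta>_eq] sign' by blast
  have nonneg: "L1_norm f \<ge> 0" "L11_norm f \<ge> 0" "L2_norm f \<ge> 0" for f :: "real ^ 'n \<Rightarrow> complex"
    by (auto simp: L1_norm_def L11_norm_def L2_norm_on_def)
  show ?thesis
  proof (intro exI conjI allI impI)
    show "max C1 C2 > 0" "\<delta> / 2 > 0" using C1(1) assms(2) by auto
    fix u0 u1 :: "real ^ 'n \<Rightarrow> complex" and u
    assume "in_H1 u0 \<and> in_L1 u0 \<and> in_L2 u1 \<and> in_L11 u1 \<and> mild_solution \<mu> u0 u1 u"
    then have u: "in_L1 u0" "in_L2 u0" "in_L11 u1" "in_L2 u1" "in_L1 u1" "mild_solution \<mu> u0 u1 u"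
      by (auto simp: in_H1_def in_L11_def)
    show "\<forall>\<^sub>F t in at_top.
        (let P1 = (\<integral>x. u1 x \<partial>lebesgue); D = (\<lambda>\<xi>. fourier (u t) \<xi> - nu \<mu> P1 t \<xi>) in
          in_L2_on {\<xi>. norm \<xi> \<le> \<delta>} D \<and>
          L2_norm_on {\<xi>. norm \<xi> \<le> \<delta>} D
            \<le> max C1 C2 * (L2_norm u0 + L1_norm u0 + L2_norm u1 + L11_norm u1)
                * t powr (- (real CARD('n) / 2))) \<and>
        in_L2_on {\<xi>. norm \<xi> \<ge> \<delta>} (fourier (u t)) \<and>
        L2_norm_on {\<xi>. norm \<xi> \<ge> \<delta>} (fourier (u t))
          \<le> max C1 C2 * (L1_norm u0 + L1_norm u1) * exp (- (\<delta> / 2) * t)"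
      using eventually_ge_at_top[of "real (DIM(real ^ 'n)) + 4"]
    proof eventually_elim
      case (elim t)
      have t: "t > 0" using elim by linarith
      have low: "C1 * (L1_norm u0 + L11_norm u1) * t powr (- (real CARD('n) / 2))
          \<le> max C1 C2 * (L2_norm u0 + L1_norm u0 + L2_norm u1 + L11_norm u1) * t powr (- (real CARD('n) / 2))"
        using C1(1) nonneg[of u0] nonneg[of u1] by (intro mult_right_mono mult_mono) auto
      have high: "C2 * (L1_norm u0 + L1_norm u1) * exp (- (\<delta> / 2) * t)
          \<le> max C1 C2 * (L1_norm u0 + L1_norm u1) * exp (- (\<delta> / 2) * t)"
        using nonneg[of u0] nonneg[of u1] by (intro mult_right_mono) auto
      show ?case
        using C1(2)[OF u(1-4,6) t] C2(2)[OF u(1,2,5,4,6) elim] low high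
        by (auto simp: Let_def)
    qed
  qed
qed

end
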